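(* Let $X_0, X_1, \dots, X_n \subset \mathbb{R}^n$ be non-empty finite sets and let $K\subset\mathbb R^n$ be a generating set whose interior contains the origin and all of the sets $X_0, X_1, \dots, X_n$. Suppose that every system of representatives $x_0\in X_0$, $x_1\in X_1$, $\ldots$, $x_n\in X_n$ can be separated from the origin by a translate $K-t$ ($t\in\mathbb R^n$). Then there exist indices $0\leq i < j \leq n$ and a translate of $K$ that separates $X_i\cup X_j$ from the origin.
   Context: A convex body is a compact convex subset of $\mathbb R^n$ with nonempty interior; a convex compactum is a compact convex set. For a convex body $K$ and a set $T\subset\mathbb R^n$ write $K\dot{-}T=\bigcap_{t\in T}(K-t)$. A convex body $K$ is a generating set if for every $T\subset\mathbb R^n$ with $K\dot{-}T\neq\emptyset$, the set $K\dot{-}T$ is a Minkowski summand of $K$, i.e. $(K\dot{-}T)+T'=K$ for some convex compactum $T'$. A translate $K-t$ separates a set $S$ from the origin if $S\subseteq K-t$ and $0\notin K-t$. *)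

theory Defs
  imports "HOL-Analysis.Analysis" "HOL-Library.Set_Algebras"
begin

definition convex_body :: "(real ^ 'n) set \<Rightarrow> bool" where
  "convex_body K \<longleftrightarrow> compact K \<and> convex K \<and> interior K \<noteq> {}"

definition translate_by :: "(real ^ 'n) set \<Rightarrow> real ^ 'n \<Rightarrow> (real ^ 'n) set" where
  "translate_by K t = (\<lambda>x. x - t) ` K"

definition minkowski_diff :: "(real ^ 'n) set \<Rightarrow> (real ^ 'n) set \<Rightarrow> (real ^ 'n) set" where
  "minkowski_diff K T = (\<Inter>t\<in>T. translate_by K t)"

text \<open>The sum of sets below is the Minkowski sum of \<^theory>\<open>HOL-Library.Set_Algebras\<close>.\<close>

definition minkowski_summand :: "(real ^ 'n) set \<Rightarrow> (real ^ 'n) set \<Rightarrow> bool" where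
  "minkowski_summand A K \<longleftrightarrow> (\<exists>T'. compact T' \<and> convex T' \<and> A + T' = K)"

text \<open>The set \<open>T\<close> has to be nonempty: the empty intersection is the whole
  space, which is not a summand of any convex body.\<close>

definition generating_set :: "(real ^ 'n) set \<Rightarrow> bool" where
  "generating_set K \<longleftrightarrow> convex_body K \<and>
     (\<forall>T. T \<noteq> {} \<and> minkowski_diff K T \<noteq> {} \<longrightarrow> minkowski_summand (minkowski_diff K T) K)"

definition separates_from_origin ::
  "(real ^ 'n) set \<Rightarrow> real ^ 'n \<Rightarrow> (real ^ 'n) set \<Rightarrow> bool" where
  "separates_from_origin K t S \<longleftrightarrow> S \<subseteq> translate_by K t \<and> 0 \<notin> translate_by K t"

end

theory Submission
  imports Defs
begin

text \<open>Write \<open>L\<^sub>A\<close> for \<open>minkowski_diff K A\<close>, so that \<open>A\<close> can be separated from the origin iff \<open>L\<^sub>A\<close> is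
  not contained in \<open>K\<close>.  If the conclusion fails, then at every frontier point \<open>p\<close> of \<open>K\<close> all
  colours \<open>i\<close> but at most one have a point \<open>x \<in> X i\<close> with \<open>p + x \<notin> interior K\<close>.  By general
  position one can choose continuous weights on the points of all \<open>X i\<close>, depending on \<open>p \<in> K\<close>,
  whose support is never empty, uses at most one point per colour, and on the frontier consists of
  such points \<open>x\<close> (up to a small error).  Supports are separable, so a separating point
  \<open>f p \<notin> K\<close> with \<open>f p + x \<in> K\<close> for some \<open>x\<close> in the support can be found.  Since \<open>K\<close> is generating,
  the directions in which \<open>L\<^sub>A\<close> sticks out of \<open>K\<close> form a convex cone, decreasing in \<open>A\<close>; this
  allows to choose \<open>f\<close> continuously.  Brouwer's theorem for the radial projection of \<open>f\<close>
  to the frontier gives \<open>p\<close> with \<open>f p = \<rho> p\<close>, \<open>\<rho> > 1\<close>; then \<open>p + x\<close> lies well inside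
  \<open>K\<close>, a contradiction.\<close>

section \<open>The gauge of a convex body and radial projection to its frontier\<close>

text \<open>\<open>g\<close> is the gauge of \<open>K\<close>, obtained as the support function of
  the polar set \<open>P\<close>. A ball of radius \<open>r\<close> inside \<open>K\<close> bounds
  \<open>P\<close> by \<open>1 / r\<close>, which makes \<open>g\<close> Lipschitz; hyperplane
  separation gives \<open>1 < g q\<close> off \<open>K\<close>.\<close>

lemma radial_projection_exists:
  fixes K :: "'a::euclidean_space set"
  assumes "compact K" "convex K" "0 \<in> interior K"
  obtains g where "continuous_on UNIV g"
    "\<And>q. q \<notin> K \<Longrightarrow> 1 < g q \<and> (1 / g q) *\<^sub>R q \<in> frontier K"
proof -
  obtain r where r: "r > 0" "cball 0 r \<subseteq> K"
    using assms(3) mem_interior_cball by blast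
  have "0 \<in> K" using assms(3) interior_subset by blast
  define P where "P = {a::'a. \<forall>k\<in>K. a \<bullet> k \<le> 1}"
  define g where "g q = (SUP a\<in>P. a \<bullet> q)" for q
  have P0: "0 \<in> P" by (simp add: P_def)
  have nP: "norm a \<le> 1 / r" if "a \<in> P" for a
  proof (cases "a = 0")
    case False
    have "(r / norm a) *\<^sub>R a \<in> K" using r False by (intro subsetD[OF r(2)]) auto
    then have "a \<bullet> ((r / norm a) *\<^sub>R a) \<le> 1" using that by (auto simp: P_def)
    then show ?thesis using False r by (simp add: dot_square_norm power2_eq_square field_simps)
  qed (use r in auto)
  have inner_le: "a \<bullet> q \<le> norm q / r" if "a \<in> P" for a q
    using norm_cauchy_schwarz[of a q] mult_right_mono[OF nP[OF that], of "norm q"] by simp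
  have upper: "a \<bullet> q \<le> g q" if "a \<in> P" for a q
    unfolding g_def using that inner_le by (intro cSUP_upper bdd_aboveI2) auto
  have least: "g q \<le> c" if "\<And>a. a \<in> P \<Longrightarrow> a \<bullet> q \<le> c" for q c
    unfolding g_def using that P0 by (intro cSUP_least) auto
  have lip1: "g x \<le> g y + (1 / r) * dist x y" for x y
  proof (rule least)
    fix a assume a: "a \<in> P"
    have "a \<bullet> x = a \<bullet> y + a \<bullet> (x - y)" by (simp add: inner_diff_right)
    then show "a \<bullet> x \<le> g y + (1 / r) * dist x y"
      using upper[OF a, of y] inner_le[OF a, of "x - y"] by (simp add: dist_norm)
  qed
  have "(1 / r)-lipschitz_on UNIV g"
  proof (rule lipschitz_onI)
    show "dist (g x) (g y) \<le> 1 / r * dist x y" for x y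
      using lip1[of x y] lip1[of y x] by (auto simp: dist_real_def dist_commute abs_le_iff)
  qed (use r in auto)
  then have cont: "continuous_on UNIV g" by (rule lipschitz_on_continuous_on)
  have sep: "\<exists>a\<in>P. 1 < a \<bullet> q" if q: "q \<notin> K" for q
  proof -
    obtain a b where ab: "a \<bullet> q < b" "\<forall>x\<in>K. b < a \<bullet> x"
      using separating_hyperplane_closed_point[OF assms(2) compact_imp_closed[OF assms(1)] q] by blast
    then have b: "b < 0" using \<open>0 \<in> K\<close> by fastforce
    have "(1 / b) *\<^sub>R a \<in> P" using ab b by (auto simp: P_def divide_le_eq intro: less_imp_le)
    moreover have "1 < ((1 / b) *\<^sub>R a) \<bullet> q" using ab b by (simp add: less_divide_eq)
    ultimately show ?thesis by blast
  qed
  have "1 < g q \<and> (1 / g q) *\<^sub>R q \<in> frontier K" if q: "q \<notin> K" for q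
  proof -
    obtain a where "a \<in> P" "1 < a \<bullet> q" using sep[OF q] by blast
    then have g1: "1 < g q" using upper[of a q] by simp
    have inK: "(1 / g q) *\<^sub>R q \<in> K"
    proof (rule ccontr)
      assume "(1 / g q) *\<^sub>R q \<notin> K"
      then obtain a where a: "a \<in> P" "1 < a \<bullet> ((1 / g q) *\<^sub>R q)" using sep by blast
      then have "g q < a \<bullet> q" using g1 by (simp add: less_divide_eq)
      with upper[OF a(1), of q] show False by simp
    qed
    \<comment> \<open>From an interior point one could move outward by a factor \<open>1 + d\<close>
      within \<open>K\<close>; this would bound \<open>g q\<close> by
      \<open>g q / (1 + d)\<close>.\<close>
    have "(1 / g q) *\<^sub>R q \<notin> interior K"
    proof
      assume "(1 / g q) *\<^sub>R q \<in> interior K"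
      then obtain e where e: "e > 0" "cball ((1 / g q) *\<^sub>R q) e \<subseteq> K"
        using mem_interior_cball by blast
      define d where "d = e / norm ((1 / g q) *\<^sub>R q)"
      have q0: "q \<noteq> 0" using q \<open>0 \<in> K\<close> by auto
      have d: "d > 0" unfolding d_def using e g1 q0 by (auto intro!: divide_pos_pos)
      have "norm (d *\<^sub>R ((1 / g q) *\<^sub>R q)) = e" using g1 q0 e(1) by (simp add: d_def)
      then have "(1 / g q) *\<^sub>R q + d *\<^sub>R ((1 / g q) *\<^sub>R q) \<in> K"
        by (intro subsetD[OF e(2)]) (simp add: dist_norm)
      then have k: "((1 + d) / g q) *\<^sub>R q \<in> K" by (simp add: scaleR_add_left[symmetric] add_divide_distrib)
      have "g q \<le> g q / (1 + d)"
      proof (rule least)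
        fix a assume "a \<in> P"
        then have "a \<bullet> (((1 + d) / g q) *\<^sub>R q) \<le> 1" using k by (auto simp: P_def)
        then show "a \<bullet> q \<le> g q / (1 + d)" using d g1 by (simp add: field_simps)
      qed
      then have "g q * (1 + d) \<le> g q" using d by (simp add: field_simps)
      moreover have "g q * d > 0" using d g1 by simp
      ultimately show False by (simp add: algebra_simps)
    qed
    with inK g1 show ?thesis using closure_subset by (auto simp: frontier_def)
  qed
  then show thesis using cont that by blast
qed

section \<open>Minkowski differences and the generating property\<close>

lemma mem_minkowski_diff: "t \<in> minkowski_diff K T \<longleftrightarrow> (\<forall>x\<in>T. t + x \<in> K)"
  by (force simp: minkowski_diff_def translate_by_def image_iff algebra_simps)

lemma separates_from_origin_iff:
  "separates_from_origin K t S \<longleftrightarrow> t \<in> minkowski_diff K S \<and> t \<notin> K"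
  by (force simp: separates_from_origin_def translate_by_def mem_minkowski_diff image_iff algebra_simps)

lemma minkowski_diff_antimono: "S \<subseteq> T \<Longrightarrow> minkowski_diff K T \<subseteq> minkowski_diff K S"
  unfolding minkowski_diff_def by blast

lemma convex_minkowski_diff: "convex K \<Longrightarrow> convex (minkowski_diff K T)"
  by (auto simp: minkowski_diff_def translate_by_def intro!: convex_INT convex_translation_subtract)

lemma compact_minkowski_diff:
  assumes "compact K" "T \<noteq> {}"
  shows "compact (minkowski_diff K T)"
proof -
  obtain x where "x \<in> T" using assms by blast
  then have "minkowski_diff K T = translate_by K x \<inter> minkowski_diff K T"
    by (auto simp: minkowski_diff_def)
  moreover have "compact (translate_by K t)" for t
    using assms(1) unfolding translate_by_def by (rule compact_translation_subtract)
  ultimately show ?thesis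
    by (metis closed_INT compact_Int_closed compact_imp_closed minkowski_diff_def)
qed

text \<open>If \<open>K = L + M\<close> with \<open>L = minkowski_diff K J\<close>, then the support function of \<open>L\<close> minus that
  of \<open>K\<close> is the negative of the support function of \<open>M\<close>, hence concave.  This is the only use of
  the generating property.\<close>

lemma generating_set_excess_concave:
  assumes gen: "generating_set K" and J: "J \<noteq> {}" "minkowski_diff K J \<noteq> {}"
    and a: "\<And>A. A \<in> F \<Longrightarrow> 0 \<le> a A" "sum a F = 1"
    and F: "\<And>A. A \<in> F \<Longrightarrow> 0 < a A \<Longrightarrow> J \<subseteq> A \<and> q A \<in> minkowski_diff K A"
    and q: "\<And>A k. A \<in> F \<Longrightarrow> 0 < a A \<Longrightarrow> k \<in> K \<Longrightarrow> u A \<bullet> k + \<delta> \<le> u A \<bullet> q A"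
  shows "\<exists>z\<in>minkowski_diff K J. \<forall>k\<in>K. (\<Sum>A\<in>F. a A *\<^sub>R u A) \<bullet> k + \<delta> \<le> (\<Sum>A\<in>F. a A *\<^sub>R u A) \<bullet> z"
proof -
  let ?u = "\<Sum>A\<in>F. a A *\<^sub>R u A" and ?L = "minkowski_diff K J"
  obtain M where M: "?L + M = K"
    using gen J unfolding generating_set_def minkowski_summand_def by blast
  have "compact ?L" using gen J by (simp add: generating_set_def convex_body_def compact_minkowski_diff)
  then have "\<exists>z\<in>?L. \<forall>l\<in>?L. ?u \<bullet> l \<le> ?u \<bullet> z"
    using J(2) by (rule continuous_attains_sup) (intro continuous_intros)
  then obtain z where z: "z \<in> ?L" "\<And>l. l \<in> ?L \<Longrightarrow> ?u \<bullet> l \<le> ?u \<bullet> z" by blast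
  have m: "?u \<bullet> m \<le> - \<delta>" if "m \<in> M" for m
  proof -
    have *: "a A * (u A \<bullet> m) \<le> a A * - \<delta>" if A: "A \<in> F" for A
    proof (cases "a A = 0")
      case False
      then have pos: "0 < a A" using a(1)[OF A] by simp
      \<comment> \<open>Since \<open>J \<subseteq> A\<close>, also \<open>q A \<in> ?L\<close>, so
        \<open>q A + m\<close> is a point of \<open>K\<close>; the gap hypothesis for this point
        bounds \<open>u A \<bullet> m\<close>.\<close>
      have "q A \<in> ?L" using F[OF A pos] minkowski_diff_antimono by blast
      then have "q A + m \<in> K" using M \<open>m \<in> M\<close> set_plus_intro by blast
      from q[OF A pos this] have "u A \<bullet> m \<le> - \<delta>" by (simp add: inner_add_right)
      then show ?thesis using pos by (intro mult_left_mono) auto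
    qed simp
    have "?u \<bullet> m = (\<Sum>A\<in>F. a A * (u A \<bullet> m))" by (simp add: inner_sum_left)
    also have "\<dots> \<le> (\<Sum>A\<in>F. a A * - \<delta>)" using * by (intro sum_mono) auto
    also have "\<dots> = - \<delta>" using a(2) by (simp only: sum_distrib_right[symmetric])
    finally show ?thesis .
  qed
  have "?u \<bullet> k + \<delta> \<le> ?u \<bullet> z" if "k \<in> K" for k
  proof -
    from that have "k \<in> ?L + M" by (simp only: M)
    then obtain l m' where "l \<in> ?L" "m' \<in> M" "k = l + m'" by (rule set_plus_elim)
    with z(2)[of l] m[of m'] show ?thesis by (simp add: inner_add_right)
  qed
  with z(1) show ?thesis by blast
qed

section \<open>Tools from convexity and separation\<close>

lemma continuous_on_Max_image:
  fixes f :: "'i \<Rightarrow> 'a::topological_space \<Rightarrow> 'b::linorder_topology"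
  assumes "finite I" "I \<noteq> {}" "\<And>i. i \<in> I \<Longrightarrow> continuous_on S (f i)"
  shows "continuous_on S (\<lambda>p. Max ((\<lambda>i. f i p) ` I))"
  using assms by (induction I rule: finite_ne_induct) (auto intro!: continuous_on_max)

text \<open>Terms of weight zero drop out, so nothing is asked of their points. The weights used
  later vary with a parameter, and membership is known only where they are positive.\<close>

lemma convex_sum_support:
  assumes "convex C" "finite I" "sum a I = 1" "\<And>i. i \<in> I \<Longrightarrow> 0 \<le> a i"
    "\<And>i. i \<in> I \<Longrightarrow> 0 < a i \<Longrightarrow> y i \<in> C"
  shows "(\<Sum>i\<in>I. a i *\<^sub>R y i) \<in> C"
proof -
  let ?I = "{i\<in>I. 0 < a i}"
  have z: "a i = 0" if "i \<in> I - ?I" for i using that assms(4)[of i] by auto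
  have "sum a ?I = sum a I"
    using assms(2) z by (intro sum.mono_neutral_left) auto
  moreover have "(\<Sum>i\<in>?I. a i *\<^sub>R y i) = (\<Sum>i\<in>I. a i *\<^sub>R y i)"
    using assms(2) z by (intro sum.mono_neutral_left) auto
  moreover have "sum a ?I = 1 \<Longrightarrow> (\<Sum>i\<in>?I. a i *\<^sub>R y i) \<in> C"
    using assms by (intro convex_sum) auto
  ultimately show ?thesis using assms(3) by simp
qed

lemma separating_unit_direction:
  fixes K :: "'a::{real_inner,heine_borel} set"
  assumes "convex K" "closed K" "t \<notin> K"
  obtains u \<delta> where "norm u \<le> 1" "0 < \<delta>" "\<And>k. k \<in> K \<Longrightarrow> u \<bullet> k + \<delta> \<le> u \<bullet> t"
proof -
  obtain a b where ab: "a \<bullet> t < b" "\<forall>x\<in>K. b < a \<bullet> x"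
    using separating_hyperplane_closed_point[OF assms] by blast
  \<comment> \<open>The added 1 avoids a division by zero: \<open>a = 0\<close> is possible for
    empty \<open>K\<close>.\<close>
  define s where "s = norm a + 1"
  have s: "s > 0" "norm a \<le> s" by (auto simp: s_def add_nonneg_pos)
  show thesis
  proof
    show "norm ((- 1 / s) *\<^sub>R a) \<le> 1" using s by simp
    show "0 < (b - a \<bullet> t) / s" using ab s by simp
    show "((- 1 / s) *\<^sub>R a) \<bullet> k + (b - a \<bullet> t) / s \<le> ((- 1 / s) *\<^sub>R a) \<bullet> t" if "k \<in> K" for k
      using ab that s by (simp add: field_simps less_imp_le)
  qed
qed

text \<open>Finitely many sets are involved, so the smallest gap serves them all. For inseparable
  sets only the norm bound is asserted.\<close>

lemma uniform_separating_directions: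
  fixes K :: "(real ^ 'n) set"
  assumes K: "convex K" "closed K" and fin: "finite \<A>"
  obtains u q \<delta> where "0 < \<delta>" "\<And>A. norm (u A) \<le> 1"
    "\<And>A t k. A \<in> \<A> \<Longrightarrow> separates_from_origin K t A \<Longrightarrow>
      q A \<in> minkowski_diff K A \<and> (k \<in> K \<longrightarrow> u A \<bullet> k + \<delta> \<le> u A \<bullet> q A)"
proof -
  have "\<exists>u q d. norm u \<le> 1 \<and> 0 < d \<and> ((\<exists>t. separates_from_origin K t A) \<longrightarrow>
      q \<in> minkowski_diff K A \<and> (\<forall>k\<in>K. u \<bullet> k + d \<le> u \<bullet> q))" for A
  proof (cases "\<exists>t. separates_from_origin K t A")
    case True
    then obtain t where t: "t \<in> minkowski_diff K A" "t \<notin> K" by (auto simp: separates_from_origin_iff)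
    from separating_unit_direction[OF K t(2)] show ?thesis using t(1) by metis
  next
    case False
    then show ?thesis by (intro exI[of _ 0] exI[of _ 1]) simp
  qed
  then obtain u q d where u: "\<And>A. norm (u A) \<le> 1" and d: "\<And>A. 0 < (d A :: real)"
    and q: "\<And>A t. separates_from_origin K t A \<Longrightarrow>
      q A \<in> minkowski_diff K A \<and> (\<forall>k\<in>K. u A \<bullet> k + d A \<le> u A \<bullet> q A)"
    by metis
  define \<delta> where "\<delta> = Min (insert 1 (d ` \<A>))"
  have "0 < \<delta>" using fin d by (auto simp: \<delta>_def)
  moreover have "\<delta> \<le> d A" if "A \<in> \<A>" for A using that fin by (auto simp: \<delta>_def)
  ultimately show thesis using u q by (intro that[of \<delta> u q]) force+
qed

section \<open>Continuous choice of a separating translate\<close>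

text \<open>The weights are left unnormalised: \<open>escape_map\<close> compares them with the
  largest weight at the same point and normalises afterwards.\<close>

definition separable_weights ::
    "(real ^ 'n) set \<Rightarrow> (real ^ 'n) set \<Rightarrow> (real ^ 'n \<Rightarrow> real ^ 'n \<Rightarrow> real) \<Rightarrow> bool" where
  "separable_weights K V \<mu> \<longleftrightarrow> (\<forall>x. continuous_on UNIV (\<mu> x)) \<and> (\<forall>x p. 0 \<le> \<mu> x p) \<and>
     (\<forall>p. {x\<in>V. 0 < \<mu> x p} \<noteq> {} \<and> (\<exists>t. separates_from_origin K t {x\<in>V. 0 < \<mu> x p}))"

text \<open>With \<open>m p\<close> the largest weight at \<open>p\<close>, the sets \<open>A\<close> with \<open>lo A p > 0\<close> contain all \<open>x\<close> of weight
  at least \<open>m p / 2\<close>, and those with \<open>hi A p > 0\<close> only contain \<open>x\<close> of weight above \<open>m p / 2\<close>.  Hence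
  the averaged direction \<open>v p\<close> sees \<open>L\<^sub>J\<close> outside of \<open>K\<close> for every \<open>J\<close> with \<open>hi J p > 0\<close>.  The closest
  point of \<open>L\<^sub>J\<close> to a far point in direction \<open>v p\<close> is a continuous substitute for a maximiser of
  \<open>v p\<close> on \<open>L\<^sub>J\<close>.\<close>

lemma escape_map:
  fixes K V :: "(real ^ 'n) set"
  assumes gen: "generating_set K" and V: "finite V" "V \<subseteq> K"
  obtains \<eta> where "0 < \<eta>"
    "\<And>\<mu>. separable_weights K V \<mu> \<Longrightarrow> \<exists>f. continuous_on UNIV f \<and>
       (\<forall>p. (\<exists>x\<in>V. 0 < \<mu> x p \<and> f p + x \<in> K) \<and> (\<forall>k\<in>K. \<eta> \<le> dist (f p) k))"
proof -
  let ?L = "minkowski_diff K"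
  have K: "convex K" "compact K" "closed K"
    using gen by (auto simp: generating_set_def convex_body_def compact_imp_closed)
  have L0: "0 \<in> ?L J" if "J \<subseteq> V" for J using that V by (auto simp: mem_minkowski_diff)
  have Lconv: "convex (?L J)" for J using K by (simp add: convex_minkowski_diff)
  have Lclosed: "closed (?L J)" for J
    unfolding minkowski_diff_def translate_by_def
    using K by (intro closed_INT ballI closed_translation_subtract)
  obtain B where B: "B > 0" "\<And>k. k \<in> K \<Longrightarrow> norm k \<le> B"
    using compact_imp_bounded[OF K(2)] unfolding bounded_pos by blast
  have LB: "norm y \<le> 2 * B" if "y \<in> ?L J" "x \<in> J" "x \<in> V" for x y J
  proof -
    have "y + x \<in> K" "x \<in> K" using that V by (auto simp: mem_minkowski_diff)
    then show ?thesis using B(2)[of "y + x"] B(2)[of x] norm_triangle_ineq4[of "y + x" x] by simp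
  qed
  obtain u q \<delta> where \<delta>: "0 < \<delta>" and u: "\<And>A. norm (u A) \<le> 1"
    and q: "\<And>A t k. A \<in> Pow V \<Longrightarrow> separates_from_origin K t A \<Longrightarrow>
      q A \<in> ?L A \<and> (k \<in> K \<longrightarrow> u A \<bullet> k + \<delta> \<le> u A \<bullet> q A)"
    by (rule uniform_separating_directions[OF K(1,3) finite_Pow_iff[THEN iffD2, OF V(1)]]) (rule that)
  \<comment> \<open>Balances the estimate \<open>(2 * B) * (4 * B)\<close> in the closest-point
    inequality below, so that it costs at most half of the gap \<open>\<delta>\<close>.\<close>
  define R where "R = 16 * B\<^sup>2 / \<delta>"
  have R: "R > 0" using B \<delta> by (simp add: R_def)
  show thesis
  proof
    show "0 < \<delta> / 2" using \<delta> by simp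
    fix \<mu> :: "real ^ 'n \<Rightarrow> real ^ 'n \<Rightarrow> real"
    assume "separable_weights K V \<mu>"
    then have cont: "\<And>x. continuous_on UNIV (\<mu> x)" and \<mu>0: "\<And>x p. 0 \<le> \<mu> x p"
      and ne: "\<And>p. {x\<in>V. 0 < \<mu> x p} \<noteq> {}"
      and sep: "\<And>p. \<exists>t. separates_from_origin K t {x\<in>V. 0 < \<mu> x p}"
      unfolding separable_weights_def by auto
    have Vne: "V \<noteq> {}" using ne by blast
    define m where "m p = Max ((\<lambda>x. \<mu> x p) ` V)" for p
    have contm: "continuous_on UNIV m"
      unfolding m_def using V(1) Vne cont by (intro continuous_on_Max_image)
    have le_m: "\<mu> x p \<le> m p" if "x \<in> V" for x p using that V(1) by (simp add: m_def)
    have ex_m: "\<exists>x\<in>V. \<mu> x p = m p" for p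
    proof -
      have "m p \<in> (\<lambda>x. \<mu> x p) ` V" unfolding m_def using V(1) Vne by (intro Max_in) auto
      then show ?thesis by force
    qed
    have m0: "0 < m p" for p
    proof -
      obtain x where "x \<in> V" "0 < \<mu> x p" using ne[of p] by blast
      then show ?thesis using le_m[of x p] by simp
    qed
    \<comment> \<open>For \<open>A \<subseteq> V\<close>, \<open>lo A p > 0\<close> also forces
      \<open>A\<close> into the support at \<open>p\<close>, so that \<open>A\<close> is separable;
      \<open>hi A p > 0\<close> forces every point of largest weight into \<open>A\<close>, so that
      all these sets share a point.\<close>
    define lo where "lo A p = (\<Prod>x\<in>A. \<mu> x p) * (\<Prod>x\<in>V - A. max 0 (m p / 2 - \<mu> x p))" for A p
    define hi where "hi A p = (\<Prod>x\<in>A. max 0 (\<mu> x p - m p / 2)) * (\<Prod>x\<in>V - A. m p - \<mu> x p)" for A p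
    have nonneg: "0 \<le> lo A p" "0 \<le> hi A p" for A p
      unfolding lo_def hi_def by (intro mult_nonneg_nonneg prod_nonneg; simp add: \<mu>0 le_m)+
    have mx: "max 0 t \<noteq> 0 \<longleftrightarrow> 0 < t" for t :: real by (auto simp: max_def)
    have lopos: "\<forall>x\<in>A. 0 < \<mu> x p" "\<forall>x\<in>V - A. \<mu> x p < m p / 2" if "0 < lo A p" "A \<subseteq> V" for A p
    proof -
      have "(\<Prod>x\<in>A. \<mu> x p) \<noteq> 0" "(\<Prod>x\<in>V - A. max 0 (m p / 2 - \<mu> x p)) \<noteq> 0"
        using that(1) by (auto simp: lo_def)
      then have *: "\<forall>x\<in>A. \<mu> x p \<noteq> 0" "\<forall>x\<in>V - A. max 0 (m p / 2 - \<mu> x p) \<noteq> 0"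
        using finite_subset[OF that(2) V(1)] V(1) by (simp_all add: prod_zero_iff)
      show "\<forall>x\<in>A. 0 < \<mu> x p" using *(1) \<mu>0 by (metis less_eq_real_def)
      show "\<forall>x\<in>V - A. \<mu> x p < m p / 2" using *(2) unfolding mx by simp
    qed
    have hipos: "\<forall>x\<in>A. m p / 2 < \<mu> x p" "\<forall>x\<in>V - A. \<mu> x p \<noteq> m p" if "0 < hi A p" "A \<subseteq> V" for A p
    proof -
      have "(\<Prod>x\<in>A. max 0 (\<mu> x p - m p / 2)) \<noteq> 0" "(\<Prod>x\<in>V - A. m p - \<mu> x p) \<noteq> 0"
        using that(1) by (auto simp: hi_def)
      then have *: "\<forall>x\<in>A. max 0 (\<mu> x p - m p / 2) \<noteq> 0" "\<forall>x\<in>V - A. m p - \<mu> x p \<noteq> 0"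
        using finite_subset[OF that(2) V(1)] V(1) by (simp_all add: prod_zero_iff)
      show "\<forall>x\<in>A. m p / 2 < \<mu> x p" using *(1) unfolding mx by simp
      show "\<forall>x\<in>V - A. \<mu> x p \<noteq> m p" using *(2) by force
    qed
    define sl where "sl p = (\<Sum>A\<in>Pow V. lo A p)" for p
    define sh where "sh p = (\<Sum>A\<in>Pow V. hi A p)" for p
    have sl: "0 < sl p" for p
    proof -
      have "0 < lo {x\<in>V. m p / 2 \<le> \<mu> x p} p"
        unfolding lo_def
      proof (intro mult_pos_pos prod_pos)
        show "0 < \<mu> x p" if "x \<in> {x\<in>V. m p / 2 \<le> \<mu> x p}" for x
          using that m0[of p] by auto
      qed auto
      then show ?thesis unfolding sl_def using V(1) nonneg
        by (intro sum_pos2[where i="{x\<in>V. m p / 2 \<le> \<mu> x p}"]) auto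
    qed
    have sh: "0 < sh p" for p
    proof -
      have "0 < hi {x\<in>V. \<mu> x p = m p} p"
        unfolding hi_def
      proof (intro mult_pos_pos prod_pos)
        show "0 < m p - \<mu> x p" if "x \<in> V - {x\<in>V. \<mu> x p = m p}" for x
          using that le_m[of x p] by auto
      qed (use m0[of p] in auto)
      then show ?thesis unfolding sh_def using V(1) nonneg
        by (intro sum_pos2[where i="{x\<in>V. \<mu> x p = m p}"]) auto
    qed
    have slsum: "(\<Sum>A\<in>Pow V. lo A p / sl p) = 1" for p
      using sl[of p] by (simp add: sum_divide_distrib[symmetric] sl_def)
    have shsum: "(\<Sum>A\<in>Pow V. hi A p / sh p) = 1" for p
      using sh[of p] by (simp add: sum_divide_distrib[symmetric] sh_def)
    define v where "v p = (\<Sum>A\<in>Pow V. (lo A p / sl p) *\<^sub>R u A)" for p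
    define y where "y J p = closest_point (?L J) (R *\<^sub>R v p)" for J p
    define f where "f p = (\<Sum>J\<in>Pow V. (hi J p / sh p) *\<^sub>R y J p)" for p
    have contlo: "continuous_on UNIV (lo A)" and conthi: "continuous_on UNIV (hi A)" for A
      unfolding lo_def hi_def by (intro continuous_intros cont contm; simp)+
    have contsl: "continuous_on UNIV sl" and contsh: "continuous_on UNIV sh"
      unfolding sl_def sh_def by (intro continuous_intros contlo conthi)+
    have contv: "continuous_on UNIV v"
      unfolding v_def by (intro continuous_intros contlo contsl) (simp add: sl[THEN less_imp_neq, symmetric])
    have conty: "continuous_on UNIV (y J)" if "J \<subseteq> V" for J
    proof -
      have "continuous_on UNIV (closest_point (?L J))"
        using Lconv Lclosed L0[OF that] by (intro continuous_on_closest_point) auto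
      moreover have "continuous_on UNIV (\<lambda>p. R *\<^sub>R v p)" by (intro continuous_intros contv)
      ultimately show ?thesis unfolding y_def by (rule continuous_on_compose2) simp
    qed
    have "continuous_on UNIV f"
      unfolding f_def
      by (intro continuous_intros conthi contsh conty) (simp_all add: sh[THEN less_imp_neq, symmetric])
    moreover have "(\<exists>x\<in>V. 0 < \<mu> x p \<and> f p + x \<in> K) \<and> (\<forall>k\<in>K. \<delta> / 2 \<le> dist (f p) k)" for p
    proof -
      obtain x where x: "x \<in> V" "\<mu> x p = m p" using ex_m by blast
      have "v p \<in> cball 0 1"
        unfolding v_def using V(1) slsum sl u nonneg
        by (intro convex_sum_support) (auto intro: divide_nonneg_pos)
      then have vn: "norm (v p) \<le> 1" by simp
      \<comment> \<open>This convex set records both claims on \<open>f p\<close>: its shift by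
        \<open>x\<close> lies in \<open>K\<close>, and \<open>v p\<close> separates it from
        \<open>K\<close> with gap \<open>\<delta> / 2\<close>. It suffices to place each averaged
        \<open>y J p\<close> in it.\<close>
      define H where "H = ?L {x} \<inter> (\<Inter>k\<in>K. {w. v p \<bullet> w \<ge> v p \<bullet> k + \<delta> / 2})"
      have yH: "y J p \<in> H" if J: "J \<subseteq> V" "0 < hi J p" for J
      proof -
        have xJ: "x \<in> J" using hipos(2)[OF J(2,1)] x by blast
        have "\<exists>z\<in>?L J. \<forall>k\<in>K. v p \<bullet> k + \<delta> \<le> v p \<bullet> z"
          unfolding v_def
        proof (rule generating_set_excess_concave[OF gen])
          show "J \<noteq> {}" using xJ by blast
          show "?L J \<noteq> {}" using L0[OF J(1)] by blast
          show "0 \<le> lo A p / sl p" for A using nonneg sl[of p] by simp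
          show "(\<Sum>A\<in>Pow V. lo A p / sl p) = 1" by (rule slsum)
          have *: "J \<subseteq> A \<and> (\<exists>t. separates_from_origin K t A)" if "A \<in> Pow V" "0 < lo A p / sl p" for A
          proof -
            have lo: "0 < lo A p" "A \<subseteq> V" using that sl[of p] by (auto simp: zero_less_divide_iff)
            have "J \<subseteq> A" using lopos(2)[OF lo] hipos(1)[OF J(2,1)] J(1)
              by (meson DiffI less_asym subset_iff)
            moreover have "A \<subseteq> {x\<in>V. 0 < \<mu> x p}" using lopos(1)[OF lo] lo(2) by blast
            then have "\<exists>t. separates_from_origin K t A"
              using sep[of p] minkowski_diff_antimono unfolding separates_from_origin_iff by blast
            ultimately show ?thesis by blast
          qed
          show "J \<subseteq> A \<and> q A \<in> ?L A" if "A \<in> Pow V" "0 < lo A p / sl p" for A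
            using *[OF that] q[OF that(1)] by blast
          show "u A \<bullet> k + \<delta> \<le> u A \<bullet> q A" if "A \<in> Pow V" "0 < lo A p / sl p" "k \<in> K" for A k
            using *[OF that(1,2)] q[OF that(1)] that(3) by blast
        qed
        then obtain z where z: "z \<in> ?L J" "\<And>k. k \<in> K \<Longrightarrow> v p \<bullet> k + \<delta> \<le> v p \<bullet> z" by blast
        have yL: "y J p \<in> ?L J" unfolding y_def using Lclosed z(1) by (intro closest_point_in_set) auto
        \<comment> \<open>The obtuse angle at the closest point \<open>y J p\<close> limits how far
          \<open>v p \<bullet> y J p\<close> falls below \<open>v p \<bullet> z\<close>: the loss is
          of order \<open>1 / R\<close>.\<close>
        have "(R *\<^sub>R v p - y J p) \<bullet> (z - y J p) \<le> 0"
          unfolding y_def by (rule closest_point_dot[OF Lconv Lclosed z(1)])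
        then have "R * (v p \<bullet> (z - y J p)) \<le> y J p \<bullet> (z - y J p)" by (simp add: inner_diff_left)
        also have "\<dots> \<le> norm (y J p) * norm (z - y J p)" by (rule norm_cauchy_schwarz)
        also have "\<dots> \<le> (2 * B) * (4 * B)"
          using LB[OF yL xJ x(1)] LB[OF z(1) xJ x(1)] norm_triangle_ineq4[of z "y J p"] B(1)
          by (intro mult_mono) auto
        also have "\<dots> = R * (\<delta> / 2)" using \<delta> by (simp add: R_def power2_eq_square)
        finally have "v p \<bullet> z - v p \<bullet> y J p \<le> \<delta> / 2" using R by (simp add: inner_diff_right)
        then have "v p \<bullet> k + \<delta> / 2 \<le> v p \<bullet> y J p" if "k \<in> K" for k using z(2)[OF that] by simp
        moreover have "y J p \<in> ?L {x}" using yL xJ by (auto simp: mem_minkowski_diff)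
        ultimately show ?thesis by (auto simp: H_def)
      qed
      have "convex H"
        unfolding H_def by (intro convex_Int convex_INT Lconv convex_halfspace_ge)
      then have fH: "f p \<in> H"
        unfolding f_def using V(1) shsum sh nonneg yH
        by (intro convex_sum_support) (auto simp: zero_less_divide_iff intro: divide_nonneg_pos dest: less_asym)
      have "\<delta> / 2 \<le> dist (f p) k" if "k \<in> K" for k
      proof -
        have "\<delta> / 2 \<le> v p \<bullet> (f p - k)" using fH that by (auto simp: H_def inner_diff_right)
        also have "\<dots> \<le> norm (v p) * norm (f p - k)" by (rule norm_cauchy_schwarz)
        also have "\<dots> \<le> 1 * norm (f p - k)" using vn by (intro mult_right_mono) auto
        finally show ?thesis by (simp add: dist_norm)
      qed
      moreover have "f p + x \<in> K" using fH by (auto simp: H_def mem_minkowski_diff)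
      moreover have "0 < \<mu> x p" using x(2) m0[of p] by simp
      ultimately show ?thesis using x(1) by blast
    qed
    ultimately show "\<exists>f. continuous_on UNIV f \<and>
       (\<forall>p. (\<exists>x\<in>V. 0 < \<mu> x p \<and> f p + x \<in> K) \<and> (\<forall>k\<in>K. \<delta> / 2 \<le> dist (f p) k))"
      by blast
  qed
qed

section \<open>General position of levels and weights with rainbow support\<close>

text \<open>The level vectors \<open>c\<close> to be avoided form Lipschitz images in \<open>'a \<times> real\<close> of the null
  sets \<open>'a \<times> {0}\<close> and \<open>frontier K \<times> UNIV\<close>; in the second case the coordinate \<open>j\<close> is left free.\<close>

lemma generic_levels:
  fixes K :: "'a::euclidean_space set" and \<phi> :: "'x \<Rightarrow> 'a \<Rightarrow> real" and X :: "nat \<Rightarrow> 'x set"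
  assumes K: "convex K" and fin: "\<And>i. i \<le> DIM('a) \<Longrightarrow> finite (X i) \<and> X i \<noteq> {}"
    and lip: "\<And>x p q. \<bar>\<phi> x p - \<phi> x q\<bar> \<le> norm (p - q)" and ab: "a < b"
  obtains c where "\<And>i. i \<le> DIM('a) \<Longrightarrow> a < c i \<and> c i < b"
    "\<And>p. \<exists>i\<le>DIM('a). \<forall>x\<in>X i. \<phi> x p \<noteq> c i"
    "\<And>p j. p \<in> frontier K \<Longrightarrow> j \<le> DIM('a) \<Longrightarrow> \<exists>i\<le>DIM('a). i \<noteq> j \<and> (\<forall>x\<in>X i. \<phi> x p \<noteq> c i)"
proof -
  let ?N = "DIM('a)"
  \<comment> \<open>A level vector is coded as a point of \<open>'a \<times> real\<close>, whose
    dimension is the number of colours: its coordinate along \<open>\<beta> i\<close> is the level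
    of colour \<open>i\<close>.\<close>
  have "card (Basis :: ('a \<times> real) set) = Suc ?N" by simp
  then obtain \<beta> where "bij_betw \<beta> {0..<Suc ?N} (Basis :: ('a \<times> real) set)"
    using ex_bij_betw_nat_finite[of "Basis :: ('a \<times> real) set"] finite_Basis by metis
  then have \<beta>: "bij_betw \<beta> {..?N} Basis" by (simp add: atLeast0LessThan lessThan_Suc_atMost)
  then have \<beta>B: "\<beta> i \<in> Basis" if "i \<le> ?N" for i using that by (auto dest: bij_betwE)
  have rep: "v = (\<Sum>i\<le>?N. (v \<bullet> \<beta> i) *\<^sub>R \<beta> i)" for v
    using sum.reindex_bij_betw[OF \<beta>, of "\<lambda>b. (v \<bullet> b) *\<^sub>R b"] by (simp add: euclidean_representation)
  have neg: "negligible ((\<lambda>v. \<Sum>i\<le>?N. h i v *\<^sub>R \<beta> i) ` S)"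
    if S: "negligible S" and h: "\<And>i v w. \<bar>h i v - h i w\<bar> \<le> norm (v - w)"
    for h :: "nat \<Rightarrow> 'a \<times> real \<Rightarrow> real" and S
  proof (rule negligible_locally_Lipschitz_image[OF order_refl S])
    fix v assume "v \<in> S"
    have "norm ((\<Sum>i\<le>?N. h i w *\<^sub>R \<beta> i) - (\<Sum>i\<le>?N. h i v *\<^sub>R \<beta> i)) \<le> real (Suc ?N) * norm (w - v)" for w
    proof -
      have "norm ((\<Sum>i\<le>?N. h i w *\<^sub>R \<beta> i) - (\<Sum>i\<le>?N. h i v *\<^sub>R \<beta> i))
          = norm (\<Sum>i\<le>?N. (h i w - h i v) *\<^sub>R \<beta> i)"
        by (simp add: sum_subtractf scaleR_diff_left)
      also have "\<dots> \<le> (\<Sum>i\<le>?N. norm (w - v))"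
        using h \<beta>B by (intro sum_norm_le) auto
      finally show ?thesis by simp
    qed
    then show "\<exists>T B. open T \<and> v \<in> T \<and> (\<forall>w\<in>S \<inter> T.
        norm ((\<Sum>i\<le>?N. h i w *\<^sub>R \<beta> i) - (\<Sum>i\<le>?N. h i v *\<^sub>R \<beta> i)) \<le> B * norm (w - v))"
      by (intro exI[of _ UNIV] exI[of _ "real (Suc ?N)"]) blast
  qed
  have lipf: "\<bar>\<phi> x (fst v) - \<phi> x (fst w)\<bar> \<le> norm (v - w)" for x and v w :: "'a \<times> real"
    using lip[of x "fst v" "fst w"] norm_fst_le[of "fst (v - w)" "snd (v - w)", unfolded prod.collapse] by simp
  \<comment> \<open>Representatives are functions restricted to the colours, so that there are
    finitely many systems and hence finitely many null sets.\<close>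
  define C where "C = PiE {..?N} X"
  have finC: "finite C" unfolding C_def using fin by (intro finite_PiE) auto
  \<comment> \<open>\<open>S1 x\<close> holds the vectors whose levels \<open>x\<close> meets all at
    once at some point, \<open>S2 x j\<close> those met on the frontier by all colours but
    \<open>j\<close>. In \<open>S1\<close> a dummy real coordinate, kept at 0, raises the domain to
    the dimension of the target.\<close>
  define S1 where "S1 x = (\<lambda>v. \<Sum>i\<le>?N. \<phi> (x i) (fst v) *\<^sub>R \<beta> i) ` {v::'a \<times> real. (0, 1) \<bullet> v = 0}" for x
  define S2 where "S2 x j = (\<lambda>v. \<Sum>i\<le>?N. (if i = j then snd v else \<phi> (x i) (fst v)) *\<^sub>R \<beta> i)
      ` (frontier K \<times> UNIV)" for x j
  have "negligible {v::'a \<times> real. (0, 1) \<bullet> v = 0}"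
    by (rule negligible_hyperplane) (simp add: prod_eq_iff)
  then have n1: "negligible (S1 x)" for x 
    unfolding S1_def using lipf by (rule neg[where h="\<lambda>i v. \<phi> (x i) (fst v)"])
  have "frontier K \<times> (UNIV::real set) = frontier (K \<times> UNIV)"
    by (auto simp: frontier_def closure_Times interior_Times)
  then have "negligible (frontier K \<times> (UNIV::real set))"
    using K by (simp add: negligible_convex_frontier convex_Times)
  then have n2: "negligible (S2 x j)" for x j
    unfolding S2_def
  proof (rule neg[where h="\<lambda>i v. if i = j then snd v else \<phi> (x i) (fst v)"])
    show "\<bar>(if i = j then snd v else \<phi> (x i) (fst v)) - (if i = j then snd w else \<phi> (x i) (fst w))\<bar>
        \<le> norm (v - w)" for i v w
      using lipf[of "x i" v w] norm_snd_le[of "snd (v - w)" "fst (v - w)", unfolded prod.collapse] by auto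
  qed
  let ?bad = "(\<Union>x\<in>C. S1 x) \<union> (\<Union>x\<in>C. \<Union>j\<le>?N. S2 x j)"
  have bad: "negligible ?bad"
    using n1 n2 finC by (auto intro!: negligible_Un negligible_Union)
  let ?box = "box (\<Sum>b\<in>Basis. a *\<^sub>R b) (\<Sum>e\<in>Basis. b *\<^sub>R e) :: ('a \<times> real) set"
  have "?box \<noteq> {}" using ab by (subst box_ne_empty) auto
  then have "\<not> negligible ?box" by (intro open_not_negligible) auto
  then have "\<not> ?box \<subseteq> ?bad" using negligible_subset[OF bad] by metis
  then obtain v where v: "v \<in> ?box" "v \<notin> ?bad" by (meson subsetI)
  show thesis
  proof
    show "a < v \<bullet> \<beta> i \<and> v \<bullet> \<beta> i < b" if "i \<le> ?N" for i
      using v(1) \<beta>B[OF that] by (auto simp: mem_box)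
    show "\<exists>i\<le>?N. \<forall>x\<in>X i. \<phi> x p \<noteq> v \<bullet> \<beta> i" for p
    proof (rule ccontr)
      assume "\<not> ?thesis"
      then have "\<forall>i. \<exists>x. i \<le> ?N \<longrightarrow> x \<in> X i \<and> \<phi> x p = v \<bullet> \<beta> i" by metis
      then obtain x where x: "\<And>i. i \<le> ?N \<Longrightarrow> x i \<in> X i \<and> \<phi> (x i) p = v \<bullet> \<beta> i" by metis
      let ?x = "restrict x {..?N}"
      have "?x \<in> C" using x by (auto simp: C_def)
      moreover have "v = (\<Sum>i\<le>?N. \<phi> (?x i) (fst (p, 0::real)) *\<^sub>R \<beta> i)"
        by (subst rep) (use x in \<open>auto intro!: sum.cong\<close>)
      then have "v \<in> S1 ?x" unfolding S1_def by (intro image_eqI[where x="(p, 0)"]) auto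
      ultimately show False using v(2) by blast
    qed
    show "\<exists>i\<le>?N. i \<noteq> j \<and> (\<forall>x\<in>X i. \<phi> x p \<noteq> v \<bullet> \<beta> i)" if p: "p \<in> frontier K" and j: "j \<le> ?N" for p j
    proof (rule ccontr)
      assume "\<not> ?thesis"
      then have "\<forall>i. \<exists>x. i \<le> ?N \<longrightarrow> x \<in> X i \<and> (i \<noteq> j \<longrightarrow> \<phi> x p = v \<bullet> \<beta> i)"
        using fin by (metis ex_in_conv)
      then obtain x where x: "\<And>i. i \<le> ?N \<Longrightarrow> x i \<in> X i \<and> (i \<noteq> j \<longrightarrow> \<phi> (x i) p = v \<bullet> \<beta> i)" by metis
      \<comment> \<open>The free coordinate is filled with the prescribed level of colour
        \<open>j\<close> itself.\<close>
      let ?x = "restrict x {..?N}" and ?v = "(p, v \<bullet> \<beta> j)"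
      have "?x \<in> C" using x by (auto simp: C_def)
      moreover have "v = (\<Sum>i\<le>?N. (if i = j then snd ?v else \<phi> (?x i) (fst ?v)) *\<^sub>R \<beta> i)"
        by (subst rep) (use x in \<open>auto intro!: sum.cong\<close>)
      then have "v \<in> S2 ?x j" unfolding S2_def using p by (intro image_eqI[where x="?v"]) auto
      ultimately show False using v(2) j by blast
    qed
  qed
qed

text \<open>The set \<open>Q\<close> of points of \<open>X i\<close> above the level \<open>c i\<close> is locally constant off the levels, and so
  is a representative \<open>s i Q\<close>; its weight \<open>w i Q\<close> vanishes on the levels.  For \<open>Q = {}\<close> an arbitrary
  representative is used, damped so that it disappears on \<open>F\<close>.\<close>

lemma rainbow_weights:
  fixes \<phi> :: "'x \<Rightarrow> 'a::metric_space \<Rightarrow> real" and X :: "nat \<Rightarrow> 'x set"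
  assumes fin: "\<And>i. i \<le> N \<Longrightarrow> finite (X i) \<and> X i \<noteq> {}"
    and cont: "\<And>x. continuous_on UNIV (\<phi> x)"
    and F: "closed F" "F \<noteq> {}"
    and level: "\<And>p. \<exists>i\<le>N. \<forall>x\<in>X i. \<phi> x p \<noteq> c i"
    and levelF: "\<And>p. p \<in> F \<Longrightarrow> \<exists>i\<le>N. (\<forall>x\<in>X i. \<phi> x p \<noteq> c i) \<and> (\<exists>x\<in>X i. c i < \<phi> x p)"
  obtains \<mu> :: "'x \<Rightarrow> 'a \<Rightarrow> real"
    where "\<forall>x. continuous_on UNIV (\<mu> x) \<and> (\<forall>p. 0 \<le> \<mu> x p)"
    "\<forall>p. (\<exists>x. 0 < \<mu> x p) \<and> (\<exists>s. (\<forall>i\<le>N. s i \<in> X i) \<and> {x. 0 < \<mu> x p} \<subseteq> s ` {..N})"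
    "\<forall>p\<in>F. \<forall>x. 0 < \<mu> x p \<longrightarrow> (\<exists>i\<le>N. x \<in> X i \<and> c i < \<phi> x p)"
proof -
  define s where "s i Q = (SOME x. x \<in> (if Q = {} then X i else Q))" for i Q
  define w where "w i Q p = (\<Prod>x\<in>Q. max 0 (\<phi> x p - c i)) * (\<Prod>x\<in>X i - Q. max 0 (c i - \<phi> x p))
      * (if Q = {} then infdist p F else 1)" for i Q p
  define \<mu> where "\<mu> x p = (\<Sum>i\<le>N. \<Sum>Q\<in>{Q. Q \<subseteq> X i \<and> s i Q = x}. w i Q p)" for x p
  define T where "T i p = {x\<in>X i. c i < \<phi> x p}" for i p
  have TX: "T i p \<subseteq> X i" for i p by (auto simp: T_def)
  have sT: "s i (T i p) \<in> X i" "T i p \<noteq> {} \<Longrightarrow> s i (T i p) \<in> T i p" if "i \<le> N" for i p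
  proof -
    have "\<exists>x. x \<in> (if T i p = {} then X i else T i p)" using fin[OF that] by auto
    then have "s i (T i p) \<in> (if T i p = {} then X i else T i p)" unfolding s_def by (rule someI_ex)
    then show "s i (T i p) \<in> X i" "T i p \<noteq> {} \<Longrightarrow> s i (T i p) \<in> T i p"
      using TX[of i p] by (auto split: if_splits)
  qed
  have finQ: "finite {Q. Q \<subseteq> X i \<and> s i Q = x}" if "i \<le> N" for i x
    using fin[OF that] by simp
  have w0: "0 \<le> w i Q p" for i Q p
    unfolding w_def by (intro mult_nonneg_nonneg prod_nonneg) (simp_all add: infdist_nonneg)
  \<comment> \<open>For each colour only \<open>Q = T i p\<close> can have positive weight, so the
    colour contributes at most the single point \<open>s i (T i p)\<close> to the support.\<close>
  have wpos: "Q = T i p \<and> (Q = {} \<longrightarrow> p \<notin> F)" if "0 < w i Q p" "Q \<subseteq> X i" "i \<le> N" for i Q p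
  proof -
    have "(\<Prod>x\<in>Q. max 0 (\<phi> x p - c i)) \<noteq> 0" "(\<Prod>x\<in>X i - Q. max 0 (c i - \<phi> x p)) \<noteq> 0"
      "Q = {} \<longrightarrow> infdist p F \<noteq> 0"
      using that(1) by (auto simp: w_def)
    moreover have "finite Q" "finite (X i - Q)" using fin[OF that(3)] that(2) finite_subset by auto
    ultimately have "\<forall>x\<in>Q. max 0 (\<phi> x p - c i) \<noteq> 0" "\<forall>x\<in>X i - Q. max 0 (c i - \<phi> x p) \<noteq> 0"
      "Q = {} \<longrightarrow> p \<notin> F"
      using infdist_zero by (auto simp: prod_zero_iff)
    moreover have mx: "max 0 t \<noteq> 0 \<longleftrightarrow> 0 < t" for t :: real by (auto simp: max_def)
    ultimately have "\<forall>x\<in>Q. c i < \<phi> x p" "\<forall>x\<in>X i - Q. \<phi> x p < c i" "Q = {} \<longrightarrow> p \<notin> F"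
      by (simp_all add: mx)
    then show ?thesis using that(2) by (force simp: T_def)
  qed
  have \<mu>pos: "\<exists>i\<le>N. s i (T i p) = x \<and> (T i p = {} \<longrightarrow> p \<notin> F)" if "0 < \<mu> x p" for x p
  proof -
    from that obtain i where i: "i \<le> N" "0 < (\<Sum>Q\<in>{Q. Q \<subseteq> X i \<and> s i Q = x}. w i Q p)"
      unfolding \<mu>_def by (meson atMost_iff not_le sum_nonpos)
    have "\<exists>Q\<in>{Q. Q \<subseteq> X i \<and> s i Q = x}. 0 < w i Q p"
    proof (rule ccontr)
      assume "\<not> ?thesis"
      then have "(\<Sum>Q\<in>{Q. Q \<subseteq> X i \<and> s i Q = x}. w i Q p) \<le> 0"
        by (intro sum_nonpos) (simp add: not_less)
      with i(2) show False by simp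
    qed
    then obtain Q where "Q \<subseteq> X i" "s i Q = x" "0 < w i Q p" by blast
    with wpos[of i Q p] i(1) show ?thesis by blast
  qed
  show thesis
  proof (rule that[of \<mu>]; intro allI ballI impI conjI)
    show "continuous_on UNIV (\<mu> x)" for x
      unfolding \<mu>_def w_def
    proof (intro continuous_intros cont)
      show "continuous_on UNIV (\<lambda>p. if Q = {} then infdist p F else 1)" for Q :: "'x set"
        by (cases "Q = {}") (auto intro!: continuous_intros)
    qed
    show "0 \<le> \<mu> x p" for x p by (auto simp: \<mu>_def intro!: sum_nonneg w0)
    show "\<exists>x. 0 < \<mu> x p" for p
    proof -
      \<comment> \<open>On \<open>F\<close> the colour comes from \<open>levelF\<close>, which makes
        \<open>T i p\<close> nonempty and so avoids the damping; off \<open>F\<close> the damping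
        factor is positive and any colour off its level will do.\<close>
      obtain i where i: "i \<le> N" "\<forall>x\<in>X i. \<phi> x p \<noteq> c i" "p \<in> F \<Longrightarrow> T i p \<noteq> {}"
        using level[of p] levelF[of p] unfolding T_def by (cases "p \<in> F") blast+
      have "0 < w i (T i p) p"
        unfolding w_def
      proof (intro mult_pos_pos prod_pos)
        show "0 < (if T i p = {} then infdist p F else 1)"
          using i(3) F by (auto intro!: infdist_pos_not_in_closed)
      qed (use i(2) in \<open>force simp: T_def\<close>)+
      also have "\<dots> \<le> (\<Sum>Q\<in>{Q. Q \<subseteq> X i \<and> s i Q = s i (T i p)}. w i Q p)"
        using finQ[OF i(1)] w0 by (intro member_le_sum) (auto simp: T_def)
      also have "\<dots> \<le> \<mu> (s i (T i p)) p"
        unfolding \<mu>_def using i(1) w0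
        by (intro member_le_sum[where f="\<lambda>i'. \<Sum>Q\<in>{Q. Q \<subseteq> X i' \<and> s i' Q = s i (T i p)}. w i' Q p"])
          (auto intro!: sum_nonneg)
      finally show ?thesis by blast
    qed
    show "\<exists>s. (\<forall>i\<le>N. s i \<in> X i) \<and> {x. 0 < \<mu> x p} \<subseteq> s ` {..N}" for p
      using \<mu>pos sT(1) by (intro exI[of _ "\<lambda>i. s i (T i p)"]) blast
    show "\<exists>i\<le>N. x \<in> X i \<and> c i < \<phi> x p" if "p \<in> F" "0 < \<mu> x p" for p x
      using \<mu>pos[OF that(2)] sT(2) that(1) by (fastforce simp: T_def)
  qed
qed

section \<open>Brouwer's fixed point theorem\<close>

text \<open>At a Brouwer fixed point, \<open>p + x\<close> is a convex combination of
  \<open>f p + x \<in> K\<close> and of \<open>x\<close>, around which a whole ball lies in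
  \<open>K\<close>. The radius is fixed before \<open>\<mu>\<close> because the weights are later
  built from levels that depend on it.\<close>

lemma frontier_hit:
  fixes K V :: "(real ^ 'n) set"
  assumes gen: "generating_set K" and K0: "0 \<in> interior K"
    and V: "finite V" "V \<subseteq> interior K"
  obtains \<epsilon> where "0 < \<epsilon>"
    "\<And>\<mu>. separable_weights K V \<mu> \<Longrightarrow> \<exists>p\<in>frontier K. \<exists>x\<in>V. 0 < \<mu> x p \<and> ball (p + x) \<epsilon> \<subseteq> K"
proof -
  have K: "convex K" "compact K" "closed K"
    using gen by (auto simp: generating_set_def convex_body_def compact_imp_closed)
  have VK: "V \<subseteq> K" using V(2) interior_subset by blast
  obtain g where contg: "continuous_on UNIV g"
    and g: "\<And>q. q \<notin> K \<Longrightarrow> 1 < g q \<and> (1 / g q) *\<^sub>R q \<in> frontier K"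
    by (rule radial_projection_exists[OF K(2,1) K0]) (rule that)
  obtain B where B: "B > 0" "\<And>k. k \<in> K \<Longrightarrow> norm k \<le> B"
    using compact_imp_bounded[OF K(2)] unfolding bounded_pos by blast
  have "\<forall>x\<in>V. \<exists>r>0. ball x r \<subseteq> K" using V(2) mem_interior by blast
  then obtain r0 where r0: "\<And>x. x \<in> V \<Longrightarrow> 0 < r0 x \<and> ball x (r0 x) \<subseteq> K" by metis
  define r where "r = Min (insert 1 (r0 ` V))"
  have r: "0 < r" using V(1) r0 by (auto simp: r_def)
  have rV: "ball x r \<subseteq> K" if "x \<in> V" for x
  proof -
    have "r \<le> r0 x" using that V(1) by (simp add: r_def)
    then show ?thesis using r0[OF that] subset_ball by blast
  qed
  obtain \<eta> where \<eta>: "0 < \<eta>"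
    and esc: "\<And>\<mu>. separable_weights K V \<mu> \<Longrightarrow> \<exists>f. continuous_on UNIV f \<and>
       (\<forall>p. (\<exists>x\<in>V. 0 < \<mu> x p \<and> f p + x \<in> K) \<and> (\<forall>k\<in>K. \<eta> \<le> dist (f p) k))"
    using escape_map[OF gen V(1) VK] by blast
  \<comment> \<open>A lower bound for \<open>1 - 1 / \<rho>\<close>: a fixed point \<open>p\<close>
    has norm at most \<open>B\<close> and distance at least \<open>\<eta>\<close> from
    \<open>\<rho> *\<^sub>R p\<close>.\<close>
  define \<tau> where "\<tau> = \<eta> / (B + \<eta>)"
  have \<tau>: "0 < \<tau>" using \<eta> B(1) by (simp add: \<tau>_def)
  show thesis
  proof
    show "0 < \<tau> * r" using \<tau> r by simp
    fix \<mu> :: "real ^ 'n \<Rightarrow> real ^ 'n \<Rightarrow> real"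
    assume \<mu>: "separable_weights K V \<mu>"
    obtain f :: "real ^ 'n \<Rightarrow> real ^ 'n" where contf: "continuous_on UNIV f"
      and f: "\<And>p. \<exists>x\<in>V. 0 < \<mu> x p \<and> f p + x \<in> K" "\<And>p k. k \<in> K \<Longrightarrow> \<eta> \<le> dist (f p) k"
      using esc[OF \<mu>] by blast
    have fK: "f p \<notin> K" for p using f(2)[of "f p" p] \<eta> by auto
    have contgf: "continuous_on UNIV (\<lambda>p. g (f p))"
      using continuous_on_compose2[OF contg contf] by simp
    have gne: "g (f p) \<noteq> 0" for p using g[OF fK, of p] by auto
    have "continuous_on UNIV (\<lambda>p. (1 / g (f p)) *\<^sub>R f p)"
      by (intro continuous_intros contf contgf) (simp add: gne)
    then have contK: "continuous_on K (\<lambda>p. (1 / g (f p)) *\<^sub>R f p)" by (rule continuous_on_subset) simp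
    have fr: "(1 / g (f p)) *\<^sub>R f p \<in> frontier K" for p using g[OF fK] by blast
    then have KK: "(\<lambda>p. (1 / g (f p)) *\<^sub>R f p) \<in> K \<rightarrow> K"
      using K(3) frontier_subset_closed by blast
    have "K \<noteq> {}" using K0 by auto
    then obtain p where p: "p \<in> K" "(1 / g (f p)) *\<^sub>R f p = p"
      by (rule brouwer[OF K(2,1) _ contK KK]) (rule that)
    define \<rho> where "\<rho> = g (f p)"
    have \<rho>: "1 < \<rho>" using g[OF fK] by (simp add: \<rho>_def)
    have fp: "f p = \<rho> *\<^sub>R p" using p(2) gne[of p] unfolding \<rho>_def
      by (metis divide_self_if mult.commute scaleR_one scaleR_scaleR times_divide_eq_right mult_1_right)
    have "\<eta> \<le> norm (\<rho> *\<^sub>R p - p)" using f(2)[OF p(1), of p] by (simp add: fp dist_norm)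
    also have "\<rho> *\<^sub>R p - p = (\<rho> - 1) *\<^sub>R p" by (simp add: scaleR_diff_left)
    also have "norm \<dots> \<le> (\<rho> - 1) * B" using \<rho> B(2)[OF p(1)] by (simp add: mult_left_mono)
    finally have \<rho>B: "\<eta> \<le> (\<rho> - 1) * B" .
    have \<tau>\<rho>: "\<tau> \<le> 1 - 1 / \<rho>"
    proof -
      have "\<eta> * \<rho> \<le> (\<rho> - 1) * (B + \<eta>)" using \<rho>B by (simp add: algebra_simps)
      then show ?thesis using \<rho> B(1) \<eta> by (simp add: \<tau>_def field_simps)
    qed
    obtain x where x: "x \<in> V" "0 < \<mu> x p" "f p + x \<in> K" using f(1) by blast
    have "ball (p + x) (\<tau> * r) \<subseteq> K"
    proof
      fix y assume y: "y \<in> ball (p + x) (\<tau> * r)"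
      define s where "s = 1 - 1 / \<rho>"
      have s: "0 < s" "s \<le> 1" "\<tau> \<le> s" using \<rho> \<tau>\<rho> by (auto simp: s_def)
      \<comment> \<open>Solves the convex combination below for its second point; as
        \<open>\<tau> \<le> s\<close>, enlarging by \<open>1 / s\<close> stays within
        \<open>r\<close> of \<open>x\<close>.\<close>
      define x' where "x' = x + (1 / s) *\<^sub>R (y - (p + x))"
      have "norm (y - (p + x)) < \<tau> * r" using y by (simp add: dist_norm norm_minus_commute)
      also have "\<dots> \<le> s * r" using s r by simp
      finally have "norm (y - (p + x)) / s < r" using s(1) by (simp add: divide_less_eq mult.commute)
      moreover have "dist x x' = norm (y - (p + x)) / s" using s(1) by (simp add: x'_def dist_norm)
      ultimately have "x' \<in> ball x r" by simp
      then have "x' \<in> K" using rV[OF x(1)] by blast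
      then have "(1 - s) *\<^sub>R (f p + x) + s *\<^sub>R x' \<in> K"
        using K(1) x(3) s by (simp add: convexD_alt)
      moreover have "(1 - s) *\<^sub>R (f p + x) + s *\<^sub>R x' = y"
      proof -
        have "(1 - s) *\<^sub>R f p = p" using \<rho> by (simp add: s_def fp)
        moreover have "s *\<^sub>R x' = s *\<^sub>R x + (y - (p + x))" using s by (simp add: x'_def scaleR_add_right)
        ultimately show ?thesis by (simp add: scaleR_add_right scaleR_diff_left)
      qed
      ultimately show "y \<in> K" by simp
    qed
    moreover have "p \<in> frontier K" using fr[of p] p(2) by simp
    ultimately show "\<exists>p\<in>frontier K. \<exists>x\<in>V. 0 < \<mu> x p \<and> ball (p + x) (\<tau> * r) \<subseteq> K"
      using x by blast
  qed
qed

section \<open>Separation near a frontier point and the final contradiction\<close>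

text \<open>The translate is by \<open>s *\<^sub>R p\<close> with \<open>s\<close> slightly above 1:
  the finitely many open conditions at \<open>p\<close> persist, while
  \<open>s *\<^sub>R p \<in> K\<close> would, together with the interior point 0, make
  \<open>p\<close> interior.\<close>

lemma frontier_interior_translate_separates:
  assumes K: "convex K" "closed K" "0 \<in> interior K" and p: "p \<in> frontier K"
    and S: "finite S" "\<And>x. x \<in> S \<Longrightarrow> p + x \<in> interior K"
  shows "\<exists>t. separates_from_origin K t S"
proof -
  have "\<forall>\<^sub>F s in at_right (1::real). s *\<^sub>R p + x \<in> interior K" if "x \<in> S" for x
  proof -
    have "((\<lambda>s. s *\<^sub>R p + x) \<longlongrightarrow> 1 *\<^sub>R p + x) (at_right 1)" by (intro tendsto_intros)
    then show ?thesis using S(2)[OF that] topological_tendstoD by fastforce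
  qed
  then have "\<forall>\<^sub>F s in at_right (1::real). \<forall>x\<in>S. s *\<^sub>R p + x \<in> interior K"
    using S(1) by (simp add: eventually_ball_finite_distrib)
  moreover have "\<forall>\<^sub>F s in at_right (1::real). 1 < s" by (simp add: eventually_at_right_less)
  ultimately have "\<forall>\<^sub>F s in at_right (1::real). 1 < s \<and> (\<forall>x\<in>S. s *\<^sub>R p + x \<in> interior K)"
    by eventually_elim simp
  then have "\<exists>s>1::real. \<forall>x\<in>S. s *\<^sub>R p + x \<in> interior K"
    by (rule eventually_happens'[OF trivial_limit_at_right_real])
  then obtain s :: real where s: "1 < s" "\<And>x. x \<in> S \<Longrightarrow> s *\<^sub>R p + x \<in> interior K"
    by blast
  have "s *\<^sub>R p \<notin> K"
  proof
    assume "s *\<^sub>R p \<in> K"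
    then have "s *\<^sub>R p - (1 - 1 / s) *\<^sub>R (s *\<^sub>R p - 0) \<in> interior K"
      using K s(1) by (intro mem_interior_convex_shrink) auto
    moreover have "s *\<^sub>R p - (1 - 1 / s) *\<^sub>R (s *\<^sub>R p - 0) = p"
      using s(1) by (simp add: algebra_simps)
    ultimately show False using p by (simp add: frontier_def)
  qed
  moreover have "s *\<^sub>R p \<in> minkowski_diff K S"
    using s(2) interior_subset by (auto simp: mem_minkowski_diff)
  ultimately show ?thesis by (auto simp: separates_from_origin_iff)
qed

theorem theorem3p2:
  fixes X :: "nat \<Rightarrow> (real ^ 'n) set" and K :: "(real ^ 'n) set"
  assumes "\<And>i. i \<le> CARD('n) \<Longrightarrow> finite (X i) \<and> X i \<noteq> {}"
    and "generating_set K"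
    and "0 \<in> interior K"
    and "\<And>i. i \<le> CARD('n) \<Longrightarrow> X i \<subseteq> interior K"
    and "\<And>x :: nat \<Rightarrow> real ^ 'n. (\<And>i. i \<le> CARD('n) \<Longrightarrow> x i \<in> X i) \<Longrightarrow>
           \<exists>t. separates_from_origin K t (x ` {..CARD('n)})"
  shows "\<exists>i j t. i < j \<and> j \<le> CARD('n) \<and> separates_from_origin K t (X i \<union> X j)"
proof (rule ccontr)
  assume contra: "\<not> ?thesis"
  have K: "convex K" "compact K" "closed K"
    using assms(2) by (auto simp: generating_set_def convex_body_def compact_imp_closed)
  have dim: "DIM(real ^ 'n) = CARD('n)" by simp
  define V where "V = (\<Union>i\<le>CARD('n). X i)"
  have V: "finite V" "V \<subseteq> interior K" using assms(1,4) by (auto simp: V_def)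
  obtain \<epsilon> where \<epsilon>: "0 < \<epsilon>"
    and hit: "\<And>\<mu>. separable_weights K V \<mu> \<Longrightarrow> \<exists>p\<in>frontier K. \<exists>x\<in>V. 0 < \<mu> x p \<and> ball (p + x) \<epsilon> \<subseteq> K"
    using frontier_hit[OF assms(2,3) V] by blast
  have out: "- interior K \<noteq> {}" "frontier K \<noteq> {}"
  proof -
    have "K \<noteq> UNIV" using K(2) compact_imp_bounded not_bounded_UNIV by blast
    moreover have "K \<noteq> {}" using assms(3) by auto
    ultimately show "frontier K \<noteq> {}" by (simp add: frontier_eq_empty)
    then show "- interior K \<noteq> {}" by (auto simp: frontier_def)
  qed
  \<comment> \<open>Negative depth of \<open>p + x\<close> in \<open>K\<close>: it is 0 exactly when
    \<open>p + x\<close> is outside the interior.\<close>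
  define \<phi> where "\<phi> x p = - infdist (p + x) (- interior K)" for x p :: "real ^ 'n"
  have lip: "\<bar>\<phi> x p - \<phi> x q\<bar> \<le> norm (p - q)" for x p q
    using infdist_triangle_abs[of "p + x" "- interior K" "q + x"] by (simp add: \<phi>_def dist_norm)
  have in_int: "p + x \<in> interior K" if "\<phi> x p < 0" for x p
    using that by (cases "p + x \<in> - interior K") (auto simp: \<phi>_def)
  \<comment> \<open>Levels below 0 keep \<open>p + x\<close> in the interior whenever
    \<open>\<phi> x p \<le> c i\<close>; levels above \<open>- \<epsilon>\<close> are what the depth
    \<open>\<epsilon>\<close> from \<open>hit\<close> will contradict.\<close>
  obtain c where c: "\<And>i. i \<le> CARD('n) \<Longrightarrow> - \<epsilon> < c i \<and> c i < 0"
    and level: "\<And>p. \<exists>i\<le>CARD('n). \<forall>x\<in>X i. \<phi> x p \<noteq> c i"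
    and levelF: "\<And>p j. p \<in> frontier K \<Longrightarrow> j \<le> CARD('n) \<Longrightarrow>
      \<exists>i\<le>CARD('n). i \<noteq> j \<and> (\<forall>x\<in>X i. \<phi> x p \<noteq> c i)"
    by (rule generic_levels[of K X \<phi> "- \<epsilon>" 0, unfolded dim, OF K(1) assms(1) lip])
      (assumption, use \<epsilon> in simp, rule that)
  have levelF': "\<exists>i\<le>CARD('n). (\<forall>x\<in>X i. \<phi> x p \<noteq> c i) \<and> (\<exists>x\<in>X i. c i < \<phi> x p)"
    if p: "p \<in> frontier K" for p
  proof -
    \<comment> \<open>Colours with no point above their level. Two of them could be separated
      together, against the assumption, so there is at most one, and \<open>levelF\<close> can be
      told to skip it.\<close>
    define E where "E = {i. i \<le> CARD('n) \<and> (\<forall>x\<in>X i. \<phi> x p \<le> c i)}"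
    have E1: "\<not> i < j" if "i \<in> E" "j \<in> E" for i j
    proof
      assume "i < j"
      have "p + x \<in> interior K" if "x \<in> X i \<union> X j" for x
        using that \<open>i \<in> E\<close> \<open>j \<in> E\<close> c[of i] c[of j] by (intro in_int) (force simp: E_def)
      then have "\<exists>t. separates_from_origin K t (X i \<union> X j)"
        using \<open>i \<in> E\<close> \<open>j \<in> E\<close> assms(1,3) K p
        by (intro frontier_interior_translate_separates) (auto simp: E_def)
      then show False using contra \<open>i < j\<close> \<open>j \<in> E\<close> by (auto simp: E_def)
    qed
    obtain j where j: "j \<le> CARD('n)" "E \<subseteq> {j}"
    proof (cases "E = {}")
      case False
      then obtain j where "j \<in> E" by blast
      moreover have "E \<subseteq> {j}" using E1 \<open>j \<in> E\<close> nat_neq_iff by blast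
      ultimately show ?thesis using that by (auto simp: E_def)
    qed (use that[of 0] in auto)
    from levelF[OF p j(1)] obtain i where i: "i \<le> CARD('n)" "i \<noteq> j" "\<forall>x\<in>X i. \<phi> x p \<noteq> c i" by blast
    then have "i \<notin> E" using j(2) by blast
    then show ?thesis using i by (auto simp: E_def not_le)
  qed
  have cont: "continuous_on UNIV (\<phi> x)" for x
    unfolding \<phi>_def by (intro continuous_intros)
  obtain \<mu> :: "real ^ 'n \<Rightarrow> real ^ 'n \<Rightarrow> real"
    where \<mu>: "\<forall>x. continuous_on UNIV (\<mu> x) \<and> (\<forall>p. 0 \<le> \<mu> x p)"
    and \<mu>s: "\<forall>p. (\<exists>x. 0 < \<mu> x p) \<and>
      (\<exists>s. (\<forall>i\<le>CARD('n). s i \<in> X i) \<and> {x. 0 < \<mu> x p} \<subseteq> s ` {..CARD('n)})"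
    and \<mu>F: "\<forall>p\<in>frontier K. \<forall>x. 0 < \<mu> x p \<longrightarrow> (\<exists>i\<le>CARD('n). x \<in> X i \<and> c i < \<phi> x p)"
    by (rule rainbow_weights[OF assms(1) cont frontier_closed out(2) level levelF'])
      (assumption, assumption, rule that)
  have supp: "{x\<in>V. 0 < \<mu> x p} = {x. 0 < \<mu> x p}" for p
  proof -
    obtain s where s: "\<And>i. i \<le> CARD('n) \<Longrightarrow> s i \<in> X i" "{x. 0 < \<mu> x p} \<subseteq> s ` {..CARD('n)}"
      using \<mu>s by blast
    have "s ` {..CARD('n)} \<subseteq> V" using s(1) by (auto simp: V_def)
    then show ?thesis using s(2) by blast
  qed
  have "separable_weights K V \<mu>"
    unfolding separable_weights_def supp
  proof (intro conjI allI)
    show "continuous_on UNIV (\<mu> x)" "0 \<le> \<mu> x p" for x p using \<mu> by auto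
    show "{x. 0 < \<mu> x p} \<noteq> {}" for p using \<mu>s by blast
    show "\<exists>t. separates_from_origin K t {x. 0 < \<mu> x p}" for p
    proof -
      obtain s where s: "\<And>i. i \<le> CARD('n) \<Longrightarrow> s i \<in> X i" "{x. 0 < \<mu> x p} \<subseteq> s ` {..CARD('n)}"
        using \<mu>s by blast
      from assms(5)[OF s(1)] show ?thesis
        unfolding separates_from_origin_iff using minkowski_diff_antimono[OF s(2)] by blast
    qed
  qed
  from hit[OF this] obtain p x where px: "p \<in> frontier K" "0 < \<mu> x p" "ball (p + x) \<epsilon> \<subseteq> K" by blast
  then obtain i where i: "i \<le> CARD('n)" "c i < \<phi> x p" using \<mu>F by blast
  \<comment> \<open>Depth at least \<open>\<epsilon>\<close> means
    \<open>\<phi> x p \<le> - \<epsilon> < c i\<close>, although points of the support lie above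
    their level.\<close>
  have "ball (p + x) \<epsilon> \<subseteq> interior K" using px(3) by (simp add: interior_maximal)
  then have "\<epsilon> \<le> infdist (p + x) (- interior K)"
    unfolding infdist_notempty[OF out(1)] using out(1) by (intro cINF_greatest) (auto simp: subset_eq not_less[symmetric])
  then show False using i c[of i] by (simp add: \<phi>_def)
qed

end
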